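(* Let $\{w_t\},\{u_{t,k}\},\{g_{t,k}\}$ be generated by memory-based distributed SGD with momentum $\beta\in[0,1)$ and learning rates $\{\eta_t\}$ (M-DSGD, described in the context), and put $\tilde u_t=\sum_{k=1}^p u_{t,k}$, $\tilde g_t=\sum_{k=1}^p g_{t,k}$, so that $\tilde g_t=\nabla f(w_t;\mathcal{I}_t)+\beta\tilde g_{t-1}$. Let $z_t=w_t+\rho_{t-1}\tilde g_{t-1}-\eta_t\tilde u_t$, where $\beta\rho_t=\beta\eta_t+\rho_{t-1}$. Assume $F$ is $L$-smooth (not necessarily convex) with $G$-bounded stochastic gradient and $\mathbb{E}\|\tilde u_t\|^2\le U^2$ for all $t$. By setting $\eta_t=\eta>0$ and $\rho_t=\beta\eta/(\beta-1)$ for all $t$, we have $$\frac{1}{(1-\beta)T}\sum_{t=0}^{T-1}\mathbb{E}\|\nabla F(w_t)\|^2\le\frac{F(w_0)-F(w^* )}{T\eta}+C\eta,$$ where $C=\dfrac{LG^2\beta}{(1-\beta)^3}+\dfrac{LGU}{1-\beta}+\dfrac{LG^2}{2(1-\beta)^2}$. In particular, taking $\eta$ of order $1/\sqrt T$ gives an $\mathcal{O}(1/\sqrt T)$ convergence rate for $\frac1T\sum_{t=0}^{T-1}\mathbb{E}\|\nabla F(w_t)\|^2$.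
   Context: $\|\cdot\|$ is the Euclidean norm. The objective is $F(w)=\frac1n\sum_{i=1}^n f(w;\zeta_i)$, $w\in\mathbb{R}^d$, where $\zeta_1,\dots,\zeta_n$ are the training data, and $w^*$ is a minimizer of $F$. M-DSGD with momentum: there are $p$ workers, an initial point $w_0$, a momentum scalar $\beta\in[0,1)$, batch size $b$ and learning rates $\eta_t$. Set $g_{-1,k}=u_{0,k}=0$ for $k=1,\dots,p$. At iterations $t=0,1,2,\dots$ each worker $k$ randomly picks a mini-batch $\mathcal{I}_{t,k}$ of $b$ training samples and a vector $m_{t,k}\in\{0,1\}^d$, and with $\odot$ the coordinatewise product and $\mathbf 1=(1,\dots,1)^T$, $$g_{t,k}=\beta g_{t-1,k}+\frac{1}{pb}\sum_{\zeta_i\in\mathcal{I}_{t,k}}\nabla f(w_t;\zeta_i),\quad u_{t+1,k}=(\mathbf 1-m_{t,k})\odot(g_{t,k}+u_{t,k}),\quad w_{t+1}=w_t-\eta_t\sum_{k=1}^p m_{t,k}\odot(g_{t,k}+u_{t,k}).$$ The aggregated mini-batch gradient $\nabla f(w_t;\mathcal{I}_t)=\frac{1}{pb}\sum_{k=1}^p\sum_{\zeta_i\in\mathcal{I}_{t,k}}\nabla f(w_t;\zeta_i)$ satisfies $\mathbb{E}[\nabla f(w_t;\mathcal{I}_t)\mid w_t]=\nabla F(w_t)$. Throughout, $\mathbb{E}_{\zeta_i}\|\nabla f(w;\zeta_i)\|^2\le G^2$ for all $w$. $F$ has $G$-bounded stochastic gradient ($G>0$) means that the stochastic gradient $g=\nabla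 f(w;\mathcal{I}_t)$ satisfies $\mathbb{E}[g\mid w]=\nabla F(w)$ and $\mathbb{E}\|g\|^2\le G^2$ for all $w$. $F$ is $L$-smooth ($L>0$) if $\|\nabla F(w)-\nabla F(w')\|\le L\|w-w'\|$ for all $w,w'$. *)

theory Defs
  imports "HOL-Probability.Probability" "HOL-Library.Multiset" "HOL-Library.Landau_Symbols"
begin

definition grad :: "('a::real_inner \<Rightarrow> real) \<Rightarrow> 'a \<Rightarrow> 'a" where
  "grad h x = (THE D. GDERIV h x :> D)"

lemma grad_eqI:
  assumes "GDERIV h x :> D"
  shows "grad h x = D"
  unfolding grad_def
proof (rule the_equality)
  fix D' assume "GDERIV h x :> D'"
  with assms have "(\<lambda>v. inner v D') = (\<lambda>v. inner v D)"
    unfolding gderiv_def by (metis has_derivative_unique)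
  then have "inner (D' - D) (D' - D) = 0"
    by (metis inner_diff_right right_minus_eq)
  then show "D' = D" by simp
qed (rule assms)

lemma GDERIV_grad:
  fixes h :: "'a::euclidean_space \<Rightarrow> real"
  assumes "h differentiable (at x)"
  shows "GDERIV h x :> grad h x"
proof -
  obtain h' where h': "(h has_derivative h') (at x)"
    using assms by (auto simp: differentiable_def)
  then interpret bounded_linear h' by (rule has_derivative_bounded_linear)
  have "h' v = inner v (\<Sum>e\<in>Basis. h' e *\<^sub>R e)" for v
  proof -
    have "h' v = h' (\<Sum>e\<in>Basis. inner v e *\<^sub>R e)" by (simp add: euclidean_representation)
    then show ?thesis by (simp add: sum scaleR inner_sum_right mult.commute)
  qed
  with h' have "GDERIV h x :> (\<Sum>e\<in>Basis. h' e *\<^sub>R e)"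
    unfolding gderiv_def by (metis (no_types, lifting) ext)
  then show ?thesis using grad_eqI by metis
qed

definition objective :: "nat \<Rightarrow> ('a \<Rightarrow> 'z \<Rightarrow> real) \<Rightarrow> (nat \<Rightarrow> 'z) \<Rightarrow> 'a \<Rightarrow> real" where
  "objective n f \<zeta> w = (1 / real n) * (\<Sum>i=1..n. f w (\<zeta> i))"

definition L_smooth :: "real \<Rightarrow> ('a::real_inner \<Rightarrow> real) \<Rightarrow> bool" where
  "L_smooth L F \<longleftrightarrow> L > 0 \<and> (\<forall>w w'. norm (grad F w - grad F w') \<le> L * norm (w - w'))"

text \<open>A mini-batch is a multiset of indices into the training data, so that sampling with and
  without replacement are both covered.\<close>

definition batch_sum :: "('a::real_inner \<Rightarrow> 'z \<Rightarrow> real) \<Rightarrow> (nat \<Rightarrow> 'z) \<Rightarrow> nat multiset \<Rightarrow> 'a \<Rightarrow> 'a" where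
  "batch_sum f \<zeta> B w = (\<Sum>i\<in>#B. grad (\<lambda>v. f v (\<zeta> i)) w)"

definition aggregated_grad ::
  "('a::real_inner \<Rightarrow> 'z \<Rightarrow> real) \<Rightarrow> (nat \<Rightarrow> 'z) \<Rightarrow> nat \<Rightarrow> nat \<Rightarrow> (nat \<Rightarrow> nat multiset) \<Rightarrow> 'a \<Rightarrow> 'a" where
  "aggregated_grad f \<zeta> p b B w = (1 / (real p * real b)) *\<^sub>R (\<Sum>k=1..p. batch_sum f \<zeta> (B k) w)"

text \<open>The conditioning on the current point is expressed by requiring the two moment conditions at
  every deterministic point \<open>w\<close>; the mini-batches of an iteration are independent of the past
  (see the locale below), hence of the random iterate at which they are used.\<close>

definition bounded_stochastic_gradient ::
  "'o measure \<Rightarrow> nat \<Rightarrow> ('a::euclidean_space \<Rightarrow> 'z \<Rightarrow> real) \<Rightarrow> (nat \<Rightarrow> 'z) \<Rightarrow> nat \<Rightarrow> nat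
    \<Rightarrow> (nat \<Rightarrow> nat \<Rightarrow> 'o \<Rightarrow> nat multiset) \<Rightarrow> real \<Rightarrow> bool" where
  "bounded_stochastic_gradient M n f \<zeta> p b I G \<longleftrightarrow> G > 0 \<and>
     (\<forall>t w. (\<integral>\<omega>. aggregated_grad f \<zeta> p b (\<lambda>k. I t k \<omega>) w \<partial>M) = grad (objective n f \<zeta>) w \<and>
            (\<integral>\<omega>. (norm (aggregated_grad f \<zeta> p b (\<lambda>k. I t k \<omega>) w))\<^sup>2 \<partial>M) \<le> G\<^sup>2)"

text \<open>The sigma-algebras generated by the mini-batches of iteration \<open>t\<close>, and by all mini-batches
  and masks of the iterations before \<open>t\<close>.\<close>

definition batch_events ::
  "'o measure \<Rightarrow> nat \<Rightarrow> (nat \<Rightarrow> nat \<Rightarrow> 'o \<Rightarrow> nat multiset) \<Rightarrow> nat \<Rightarrow> 'o set set" where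
  "batch_events M p I t = sets (vimage_algebra (space M) (\<lambda>\<omega>. \<lambda>k\<in>{1..p}. I t k \<omega>)
     (\<Pi>\<^sub>M k\<in>{1..p}. count_space UNIV))"

definition past_events ::
  "'o measure \<Rightarrow> nat \<Rightarrow> (nat \<Rightarrow> nat \<Rightarrow> 'o \<Rightarrow> nat multiset)
    \<Rightarrow> (nat \<Rightarrow> nat \<Rightarrow> 'o \<Rightarrow> real^'d) \<Rightarrow> nat \<Rightarrow> 'o set set" where
  "past_events M p I m t = sets (vimage_algebra (space M)
     (\<lambda>\<omega>. \<lambda>(s, k)\<in>{..<t} \<times> {1..p}. (I s k \<omega>, m s k \<omega>))
     (\<Pi>\<^sub>M (s, k)\<in>{..<t} \<times> {1..p}. count_space UNIV \<Otimes>\<^sub>M borel))"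

text \<open>The momentum vectors \<open>g\<close> are indexed by integers because the recursion starts at index
  \<open>-1\<close>. Multiplication on \<open>real^'d\<close> is coordinatewise, and \<open>1\<close> is the all-ones vector.
  The masks \<open>m\<close> are arbitrary random 0/1-vectors: \<open>m t k\<close> may depend on the past, on the
  mini-batches of iteration \<open>t\<close>, and on further randomness.\<close>

locale mdsgd = prob_space M for M :: "'o measure" +
  fixes n :: nat
    and f :: "real^'d \<Rightarrow> 'z \<Rightarrow> real"
    and \<zeta> :: "nat \<Rightarrow> 'z"
    and p b :: nat
    and \<beta> :: real
    and \<eta> :: "nat \<Rightarrow> real"
    and w0 :: "real^'d"
    and I :: "nat \<Rightarrow> nat \<Rightarrow> 'o \<Rightarrow> nat multiset"
    and m :: "nat \<Rightarrow> nat \<Rightarrow> 'o \<Rightarrow> real^'d"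
    and w :: "nat \<Rightarrow> 'o \<Rightarrow> real^'d"
    and u :: "nat \<Rightarrow> nat \<Rightarrow> 'o \<Rightarrow> real^'d"
    and g :: "int \<Rightarrow> nat \<Rightarrow> 'o \<Rightarrow> real^'d"
  assumes p_pos: "p \<ge> 1"
    and b_pos: "b \<ge> 1"
    and momentum: "0 \<le> \<beta>" "\<beta> < 1"
    and batch_measurable: "\<And>t k. k \<in> {1..p} \<Longrightarrow> I t k \<in> measurable M (count_space UNIV)"
    and batch: "\<And>t k \<omega>. k \<in> {1..p} \<Longrightarrow> \<omega> \<in> space M \<Longrightarrow>
                  size (I t k \<omega>) = b \<and> set_mset (I t k \<omega>) \<subseteq> {1..n}"
    and mask_measurable: "\<And>t k. k \<in> {1..p} \<Longrightarrow> m t k \<in> borel_measurable M"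
    and mask: "\<And>t k \<omega> j. k \<in> {1..p} \<Longrightarrow> \<omega> \<in> space M \<Longrightarrow> m t k \<omega> $ j \<in> {0, 1}"
    and batch_indep_past: "\<And>t. indep_set (batch_events M p I t) (past_events M p I m t)"
    and w_0: "\<And>\<omega>. \<omega> \<in> space M \<Longrightarrow> w 0 \<omega> = w0"
    and g_init: "\<And>k \<omega>. k \<in> {1..p} \<Longrightarrow> \<omega> \<in> space M \<Longrightarrow> g (-1) k \<omega> = 0"
    and u_0: "\<And>k \<omega>. k \<in> {1..p} \<Longrightarrow> \<omega> \<in> space M \<Longrightarrow> u 0 k \<omega> = 0"
    and g_step: "\<And>t k \<omega>. k \<in> {1..p} \<Longrightarrow> \<omega> \<in> space M \<Longrightarrow>
           g (int t) k \<omega> = \<beta> *\<^sub>R g (int t - 1) k \<omega>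
             + (1 / (real p * real b)) *\<^sub>R batch_sum f \<zeta> (I t k \<omega>) (w t \<omega>)"
    and u_step: "\<And>t k \<omega>. k \<in> {1..p} \<Longrightarrow> \<omega> \<in> space M \<Longrightarrow>
           u (Suc t) k \<omega> = (1 - m t k \<omega>) * (g (int t) k \<omega> + u t k \<omega>)"
    and w_step: "\<And>t \<omega>. \<omega> \<in> space M \<Longrightarrow>
           w (Suc t) \<omega> = w t \<omega> - \<eta> t *\<^sub>R (\<Sum>k=1..p. m t k \<omega> * (g (int t) k \<omega> + u t k \<omega>))"

end

theory Submission
  imports Defs
begin

text \<open>Write \<open>\<rho>\<close> for the constant value \<open>\<beta>\<eta>/(\<beta> - 1)\<close>. Summed over the workers, the masks cancel in
  \<open>w - \<eta> u\<close>, and \<open>\<rho>\<close> is chosen so that the momentum cancels as well: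
  \<open>z (t+1) = z t - \<eta>/(1-\<beta>) h t\<close>, where \<open>h t\<close> is the stochastic gradient at \<open>w t\<close>. The descent
  inequality for \<open>F\<close> along \<open>z\<close> then telescopes, and the price for evaluating \<open>h t\<close> at \<open>w t\<close>
  instead of \<open>z t\<close> is at most \<open>L G E(norm (z t - w t))\<close>. All iterates take finitely many values,
  because there are finitely many mini-batches and masks; so integrability is automatic, and
  conditioning on the past is a finite decomposition of the sample space.\<close>

section \<open>The quadratic upper bound for smooth functions\<close>

lemma descent_lemma:
  fixes F :: "'a::real_inner \<Rightarrow> real"
  assumes deriv: "\<And>x. GDERIV F x :> grad F x" and smooth: "L_smooth L F"
  shows "F y \<le> F x + inner (y - x) (grad F x) + L / 2 * (norm (y - x))\<^sup>2"
proof -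
  define d where "d = y - x"
  \<comment> \<open>The gap between F on the segment from x to y and its quadratic upper model. The
    derivative of this gap is nonpositive because the gradient is Lipschitz, so the claim follows by
    monotonicity on [0, 1].\<close>
  define \<phi> where "\<phi> s = F (x + s *\<^sub>R d) - s * inner d (grad F x) - L / 2 * s\<^sup>2 * (norm d)\<^sup>2" for s
  have "\<phi> 1 \<le> \<phi> 0"
  proof (rule DERIV_nonpos_imp_nonincreasing[of 0 1 \<phi>])
    fix s :: real assume s: "0 \<le> s" "s \<le> 1"
    have "((\<lambda>s. F (x + s *\<^sub>R d)) has_derivative (\<lambda>h. inner (h *\<^sub>R d) (grad F (x + s *\<^sub>R d)))) (at s)"
      by (rule has_derivative_compose[OF _ deriv[unfolded gderiv_def]])
         (auto intro!: derivative_eq_intros)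
    then have F': "((\<lambda>s. F (x + s *\<^sub>R d)) has_real_derivative inner d (grad F (x + s *\<^sub>R d))) (at s)"
      by (rule has_derivative_imp_has_field_derivative) simp
    have "(\<phi> has_real_derivative
        inner d (grad F (x + s *\<^sub>R d)) - inner d (grad F x) - L * s * (norm d)\<^sup>2) (at s)"
      unfolding \<phi>_def by (rule derivative_eq_intros F' refl | simp)+
    moreover have "inner d (grad F (x + s *\<^sub>R d) - grad F x) \<le> norm d * (L * norm (s *\<^sub>R d))"
      using smooth
      by (intro order_trans[OF norm_cauchy_schwarz] mult_left_mono)
         (auto simp: L_smooth_def simp del: norm_scaleR dest: spec2[of _ "x + s *\<^sub>R d" x])
    then have "inner d (grad F (x + s *\<^sub>R d)) - inner d (grad F x) - L * s * (norm d)\<^sup>2 \<le> 0"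
      using s by (simp add: inner_diff_right power2_eq_square algebra_simps)
    ultimately show "\<exists>D. (\<phi> has_real_derivative D) (at s) \<and> D \<le> 0" by blast
  qed simp
  then show ?thesis by (simp add: \<phi>_def d_def)
qed

section \<open>Moments and independence for finitely valued random variables\<close>

context prob_space
begin

lemma integrable_simple:
  fixes X :: "'a \<Rightarrow> 'b::{banach, second_countable_topology}"
  assumes "simple_function M X"
  shows "integrable M X"
  by (rule integrable_simple_function[OF assms]) simp

text \<open>Nonnegativity of the variance. It turns second-moment hypotheses into bounds on mean
  norms.\<close>

lemma expectation_le_of_square:
  fixes X :: "'a \<Rightarrow> real"
  assumes X: "simple_function M X" and "expectation (\<lambda>\<omega>. (X \<omega>)\<^sup>2) \<le> c\<^sup>2" "0 \<le> c"
  shows "expectation X \<le> c"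
proof -
  have "(expectation X)\<^sup>2 \<le> expectation (\<lambda>\<omega>. (X \<omega>)\<^sup>2)"
    using variance_eq[OF integrable_simple[OF X] integrable_simple[OF simple_function_compose1[OF X]]]
      variance_positive[of X] by simp
  with assms show ?thesis by (meson order_trans power2_le_imp_le)
qed

text \<open>Independence is given for events, so \<open>Y\<close> is expanded over its finitely many
  level sets, which lie in \<open>Q\<close>, and the product rule is applied to each of
  them.\<close>

lemma expectation_indicator_indep:
  fixes Y :: "'a \<Rightarrow> real"
  assumes indep: "indep_set (sets Q) (sets P)" and Q: "space Q = space M"
    and Y: "simple_function Q Y" and A: "A \<in> sets P"
  shows "expectation (\<lambda>\<omega>. indicator A \<omega> * Y \<omega>) = prob A * expectation Y"
proof -
  define R where "R = Y ` space M"
  define E where "E y = Y -` {y} \<inter> space M" for y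
  have fin: "finite R" and E: "E y \<in> sets Q" for y
    using simple_functionD[OF Y] by (simp_all add: Q R_def E_def)
  have ev: "A \<in> events" "E y \<in> events" for y
    using indep_setD_ev1[OF indep] indep_setD_ev2[OF indep] A E by auto
  have dec: "(\<Sum>y\<in>R. y * indicator (E y) \<omega>) = Y \<omega>" if "\<omega> \<in> space M" for \<omega>
    using that fin
    by (subst sum.remove[of _ "Y \<omega>"]) (auto simp: R_def E_def indicator_def intro!: sum.neutral)
  have int: "integrable M (indicator B :: 'a \<Rightarrow> real)" if "B \<in> events" for B
    by (rule integrable_simple[OF simple_function_indicator[OF that]])
  have "expectation (\<lambda>\<omega>. indicator A \<omega> * Y \<omega>)
      = expectation (\<lambda>\<omega>. \<Sum>y\<in>R. y * indicator (E y \<inter> A) \<omega>)"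
    by (rule Bochner_Integration.integral_cong)
       (simp_all add: indicator_inter_arith mult.assoc[symmetric] sum_distrib_right[symmetric] dec)
  also have "\<dots> = (\<Sum>y\<in>R. y * prob (E y \<inter> A))"
    by (simp add: int ev sets.Int sets.Int_space_eq2)
  also have "\<dots> = prob A * (\<Sum>y\<in>R. y * prob (E y))"
    by (simp add: indep_setD[OF indep E A] sum_distrib_left mult_ac)
  also have "(\<Sum>y\<in>R. y * prob (E y)) = expectation (\<lambda>\<omega>. \<Sum>y\<in>R. y * indicator (E y) \<omega>)"
    by (simp add: int ev sets.Int sets.Int_space_eq2)
  also have "\<dots> = expectation Y"
    by (rule Bochner_Integration.integral_cong) (simp_all add: dec)
  finally show ?thesis .
qed

text \<open>This takes the place of conditioning on the past. On a level set of \<open>X\<close>,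
  the integrand is \<open>H x\<close> for one fixed x, and \<open>H x\<close> is independent of that
  level set.\<close>

lemma expectation_freeze:
  fixes H :: "'x \<Rightarrow> 'a \<Rightarrow> real"
  assumes indep: "indep_set (sets Q) (sets P)" and space: "space Q = space M" "space P = space M"
    and X: "simple_function P X" and H: "\<And>x. simple_function Q (H x)"
  shows "expectation (\<lambda>\<omega>. H (X \<omega>) \<omega>) = expectation (\<lambda>\<omega>. expectation (H (X \<omega>)))"
proof -
  define R where "R = X ` space M"
  define E where "E x = X -` {x} \<inter> space M" for x
  have fin: "finite R" and E: "E x \<in> sets P" for x
    using simple_functionD[OF X] by (simp_all add: space R_def E_def)
  have ev: "E x \<in> events" for x
    using indep_setD_ev2[OF indep] E by auto
  have intH: "integrable M (H x)" for x
    using indep_setD_ev1[OF indep] space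
    by (intro integrable_simple simple_function_subalgebra[OF H]) auto
  \<comment> \<open>The weight \<open>c\<close> stays arbitrary because it stands first for the
    values \<open>H x \<omega>\<close> and later for their expectations.\<close>
  have dec: "(\<Sum>x\<in>R. indicator (E x) \<omega> * c x) = c (X \<omega>)" if "\<omega> \<in> space M" for \<omega> and c :: "'x \<Rightarrow> real"
    using that fin
    by (subst sum.remove[of _ "X \<omega>"]) (auto simp: R_def E_def indicator_def intro!: sum.neutral)
  have intEH: "integrable M (\<lambda>\<omega>. indicator (E x) \<omega> * H x \<omega>)" for x
    using integrable_real_mult_indicator[OF ev intH] by (simp add: mult.commute)
  have intE: "integrable M (indicator (E x) :: 'a \<Rightarrow> real)" for x
    by (rule integrable_simple[OF simple_function_indicator[OF ev]])
  have "expectation (\<lambda>\<omega>. H (X \<omega>) \<omega>) = expectation (\<lambda>\<omega>. \<Sum>x\<in>R. indicator (E x) \<omega> * H x \<omega>)"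
    by (rule Bochner_Integration.integral_cong) (simp_all add: dec)
  also have "\<dots> = (\<Sum>x\<in>R. prob (E x) * expectation (H x))"
    by (simp add: intEH expectation_indicator_indep[OF indep space(1) H E])
  also have "\<dots> = expectation (\<lambda>\<omega>. \<Sum>x\<in>R. indicator (E x) \<omega> * expectation (H x))"
    by (simp add: intE ev sets.Int_space_eq2)
  also have "\<dots> = expectation (\<lambda>\<omega>. expectation (H (X \<omega>)))"
    by (rule Bochner_Integration.integral_cong) (simp_all add: dec)
  finally show ?thesis .
qed

end

text \<open>Such a vector is the indicator of a subset of a finite index type. It follows that masks
  are finitely valued.\<close>

lemma finite_zero_one_vectors: "finite {v :: real^'d. \<forall>j. v $ j \<in> {0, 1}}"
proof -
  have "v \<in> range (\<lambda>S. \<chi> j. if j \<in> S then 1 else 0)" if "\<forall>j. v $ j \<in> {0, 1}" for v :: "real^'d"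
    using that by (intro range_eqI[of _ _ "{j. v $ j = 1}"]) (auto simp: vec_eq_iff)
  then have "{v :: real^'d. \<forall>j. v $ j \<in> {0, 1}} \<subseteq> range (\<lambda>S. \<chi> j. if j \<in> S then 1 else 0)"
    by blast
  moreover have "finite (range (\<lambda>S :: 'd set. (\<chi> j. if j \<in> S then 1 else 0) :: real^'d))"
    by (rule finite_imageI[OF finite])
  ultimately show ?thesis by (rule finite_subset)
qed

section \<open>The algebras of batches and of the past, and the recursions summed over
  workers\<close>

context mdsgd
begin

text \<open>\<open>batch_events\<close> and \<open>past_events\<close> are only set systems; the
  same sigma-algebras are kept here as measures, the form that \<open>simple_function\<close>
  takes.\<close>

definition batch_algebra :: "nat \<Rightarrow> 'o measure" where
  "batch_algebra t = vimage_algebra (space M) (\<lambda>\<omega>. \<lambda>k\<in>{1..p}. I t k \<omega>)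
     (\<Pi>\<^sub>M k\<in>{1..p}. count_space UNIV)"

definition past_algebra :: "nat \<Rightarrow> 'o measure" where
  "past_algebra t = vimage_algebra (space M)
     (\<lambda>\<omega>. \<lambda>(s, k)\<in>{..<t} \<times> {1..p}. (I s k \<omega>, m s k \<omega>))
     (\<Pi>\<^sub>M (s, k)\<in>{..<t} \<times> {1..p}. count_space UNIV \<Otimes>\<^sub>M borel)"

text \<open>The point stays deterministic, so that only the batches of iteration t are random; the
  random iterate is substituted in \<open>step_grad\<close>.\<close>

definition stoch_grad :: "nat \<Rightarrow> real^'d \<Rightarrow> 'o \<Rightarrow> real^'d" where
  "stoch_grad t x \<omega> = aggregated_grad f \<zeta> p b (\<lambda>k. I t k \<omega>) x"

text \<open>The index shift makes \<open>gsum t\<close> the momentum known before iteration t, and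
  lets the recursion start at the natural number 0.\<close>

definition gsum :: "nat \<Rightarrow> 'o \<Rightarrow> real^'d" where
  "gsum t \<omega> = (\<Sum>k=1..p. g (int t - 1) k \<omega>)"

definition usum :: "nat \<Rightarrow> 'o \<Rightarrow> real^'d" where
  "usum t \<omega> = (\<Sum>k=1..p. u t k \<omega>)"

lemma space_algebra [simp]: "space (batch_algebra t) = space M" "space (past_algebra t) = space M"
  by (simp_all add: batch_algebra_def past_algebra_def)

lemma indep_algebras: "indep_set (sets (batch_algebra t)) (sets (past_algebra t))"
  using batch_indep_past[of t] by (simp add: batch_algebra_def past_algebra_def batch_events_def past_events_def)

lemma simple_past_imp_simple:
  "simple_function (past_algebra t) X \<Longrightarrow> simple_function M X"
  by (erule simple_function_subalgebra) (simp_all add: indep_setD_ev2[OF indep_algebras])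

lemma simple_batch_imp_simple:
  "simple_function (batch_algebra t) X \<Longrightarrow> simple_function M X"
  by (erule simple_function_subalgebra) (simp_all add: indep_setD_ev1[OF indep_algebras])

lemma finite_batch_range: "k \<in> {1..p} \<Longrightarrow> finite (I t k ` space M)"
  by (rule finite_subset[OF _ finite_multisets_of_size[of "{1..n}" b]])
     (use batch in \<open>auto simp: multisets_of_size_def\<close>)

lemma simple_batch:
  assumes k: "k \<in> {1..p}"
  shows "simple_function (batch_algebra t) (I t k)"
proof -
  have "(\<lambda>\<omega>. (\<lambda>k\<in>{1..p}. I t k \<omega>) k) \<in> measurable (batch_algebra t) (count_space UNIV)"
    unfolding batch_algebra_def
    by (rule measurable_compose[OF measurable_vimage_algebra1 measurable_component_singleton[OF k]])
       (auto simp: space_PiM)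
  then have "I t k \<in> measurable (batch_algebra t) (count_space UNIV)"
    using k by simp
  from measurable_sets[OF this] finite_batch_range[OF k] show ?thesis
    by (simp add: simple_function_def)
qed

lemma simple_past:
  assumes "k \<in> {1..p}" "s < t"
  shows "simple_function (past_algebra t) (I s k)" "simple_function (past_algebra t) (m s k)"
proof -
  have sk: "(s, k) \<in> {..<t} \<times> {1..p}" using assms by auto
  let ?N = "\<Pi>\<^sub>M (s, k)\<in>{..<t} \<times> {1..p}. (count_space UNIV :: nat multiset measure) \<Otimes>\<^sub>M (borel :: (real^'d) measure)"
  let ?\<phi> = "\<lambda>\<omega>. \<lambda>(s, k)\<in>{..<t} \<times> {1..p}. (I s k \<omega>, m s k \<omega>)"
  have "?\<phi> \<omega> \<in> space ?N" for \<omega>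
    unfolding space_PiM by (rule restrict_PiE_iff[THEN iffD2]) (simp add: split_beta space_pair_measure)
  then have "?\<phi> \<in> measurable (past_algebra t) ?N"
    unfolding past_algebra_def by (intro measurable_vimage_algebra1) auto
  from measurable_compose[OF this measurable_component_singleton[OF sk]]
  have meas: "(\<lambda>\<omega>. (I s k \<omega>, m s k \<omega>)) \<in> measurable (past_algebra t) (count_space UNIV \<Otimes>\<^sub>M borel)"
    using assms by simp
  have "I s k \<in> measurable (past_algebra t) (count_space UNIV)"
    using measurable_compose[OF meas measurable_fst] by simp
  from measurable_sets[OF this] finite_batch_range[OF assms(1)]
  show "simple_function (past_algebra t) (I s k)"
    by (simp add: simple_function_def)
  have "m s k \<in> borel_measurable (past_algebra t)"
    using measurable_compose[OF meas measurable_snd] by simp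
  moreover have "finite (m s k ` space M)"
    by (rule finite_subset[OF _ finite_zero_one_vectors]) (use mask assms in auto)
  ultimately show "simple_function (past_algebra t) (m s k)"
    by (intro simple_function_borel_measurable) simp_all
qed

text \<open>The state at time s is computed from batches and masks of iterations before s. Allowing
  every \<open>s \<le> t\<close> keeps one algebra fixed during the induction. The momentum index is
  \<open>int s - 1\<close> because \<open>g (int s) k\<close> already involves the batch of
  iteration s.\<close>

lemma simple_state:
  assumes "s \<le> t"
  shows "simple_function (past_algebra t) (w s)
    \<and> (\<forall>k\<in>{1..p}. simple_function (past_algebra t) (u s k)
        \<and> simple_function (past_algebra t) (g (int s - 1) k))"
  using assms
proof (induction s)
  case 0
  have "simple_function (past_algebra t) (w 0)"
    \<comment> \<open>The initial values are prescribed on \<open>space M\<close> only, hence a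
      congruence instead of an equation between functions.\<close>
    by (subst simple_function_cong[where g = "\<lambda>_. w0"]) (simp_all add: w_0)
  moreover have "simple_function (past_algebra t) (u 0 k)" if "k \<in> {1..p}" for k
    by (subst simple_function_cong[where g = "\<lambda>_. 0"]) (use that u_0 in simp_all)
  moreover have "simple_function (past_algebra t) (g (-1) k)" if "k \<in> {1..p}" for k
    by (subst simple_function_cong[where g = "\<lambda>_. 0"]) (use that g_init in simp_all)
  ultimately show ?case by simp
next
  case (Suc s)
  then have s: "s < t" and w: "simple_function (past_algebra t) (w s)"
    and u: "\<And>k. k \<in> {1..p} \<Longrightarrow> simple_function (past_algebra t) (u s k)"
    and g': "\<And>k. k \<in> {1..p} \<Longrightarrow> simple_function (past_algebra t) (g (int s - 1) k)" by auto
  note I = simple_past(1)[OF _ s] and m = simple_past(2)[OF _ s]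
  have g: "simple_function (past_algebra t) (g (int s) k)" if k: "k \<in> {1..p}" for k
    by (subst simple_function_cong[OF g_step[OF k]])
       (auto intro!: simple_function_compose2[where h = "\<lambda>x y. \<beta> *\<^sub>R x + y"] g'[OF k]
         simple_function_compose2[where h = "\<lambda>B x. (1 / (real p * real b)) *\<^sub>R batch_sum f \<zeta> B x"] I[OF k] w)
  have "simple_function (past_algebra t) (u (Suc s) k)" if k: "k \<in> {1..p}" for k
    by (subst simple_function_cong[OF u_step[OF k]])
       (auto intro!: simple_function_compose2[where h = "\<lambda>x y. (1 - x) * y"] m[OF k] g[OF k] u[OF k])
  moreover have "simple_function (past_algebra t) (w (Suc s))"
    by (subst simple_function_cong[OF w_step], simp)
       (intro simple_function_compose2[where h = "\<lambda>x y. x - \<eta> s *\<^sub>R y"] simple_function_sum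
          simple_function_mult simple_function_add w m g u)
  ultimately show ?case using g by simp
qed

lemma simple_w: "simple_function (past_algebra t) (w t)"
  using simple_state[of t t] by simp

lemma simple_gsum: "simple_function (past_algebra t) (gsum t)"
  unfolding gsum_def using simple_state[of t t] by (intro simple_function_sum) simp

lemma simple_usum: "simple_function (past_algebra t) (usum t)"
  unfolding usum_def using simple_state[of t t] by (intro simple_function_sum) simp

lemma simple_stoch_grad: "simple_function (batch_algebra t) (stoch_grad t x)"
  unfolding stoch_grad_def aggregated_grad_def
  by (intro simple_function_compose1[where g = "\<lambda>y. (1 / (real p * real b)) *\<^sub>R y"] simple_function_sum
      simple_function_compose1[where g = "\<lambda>B. batch_sum f \<zeta> B x"] simple_batch)

lemma gsum_0: "\<omega> \<in> space M \<Longrightarrow> gsum 0 \<omega> = 0"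
  by (simp add: gsum_def g_init)

lemma usum_0: "\<omega> \<in> space M \<Longrightarrow> usum 0 \<omega> = 0"
  by (simp add: usum_def u_0)

lemma gsum_Suc: "\<omega> \<in> space M \<Longrightarrow> gsum (Suc t) \<omega> = \<beta> *\<^sub>R gsum t \<omega> + stoch_grad t (w t \<omega>) \<omega>"
  by (simp add: gsum_def stoch_grad_def aggregated_grad_def g_step sum.distrib scaleR_sum_right)

text \<open>For each worker the transmitted part \<open>m * (g + u)\<close> and the retained part
  \<open>(1 - m) * (g + u)\<close> add up to \<open>g + u\<close>, whatever the mask. With a
  constant rate this is a recursion for \<open>w - \<eta> u\<close> that does not see the
  masks.\<close>

lemma corrected_iterate_Suc:
  assumes \<omega>: "\<omega> \<in> space M"
  shows "w (Suc t) \<omega> - \<eta> t *\<^sub>R usum (Suc t) \<omega> = w t \<omega> - \<eta> t *\<^sub>R (gsum (Suc t) \<omega> + usum t \<omega>)"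
proof -
  have "(\<Sum>k=1..p. m t k \<omega> * (g (int t) k \<omega> + u t k \<omega>)) + usum (Suc t) \<omega> = gsum (Suc t) \<omega> + usum t \<omega>"
    using \<omega> unfolding usum_def gsum_def sum.distrib[symmetric]
    by (intro sum.cong) (auto simp: u_step algebra_simps)
  then have "(\<Sum>k=1..p. m t k \<omega> * (g (int t) k \<omega> + u t k \<omega>)) = gsum (Suc t) \<omega> + usum t \<omega> - usum (Suc t) \<omega>"
    by (simp only: eq_diff_eq)
  then show ?thesis
    unfolding w_step[OF \<omega>] by (simp only: scaleR_diff_right) simp
qed

end

section \<open>Constant rate: bounds on gradients, momentum and memory\<close>

locale smooth_mdsgd = mdsgd M n f \<zeta> p b \<beta> "\<lambda>_. \<gamma>" w0 I m w u g
  for M :: "'o measure" and n f and \<zeta> :: "nat \<Rightarrow> 'z" and p b \<beta> \<gamma> and w0 :: "real^'d" and I m w u g +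
  fixes L G U :: real
  assumes diff: "\<And>i v. i \<in> {1..n} \<Longrightarrow> (\<lambda>v. f v (\<zeta> i)) differentiable (at v)"
    and smooth: "L_smooth L (objective n f \<zeta>)"
    and stochastic: "bounded_stochastic_gradient M n f \<zeta> p b I G"
    and U_nonneg: "0 \<le> U"
    and U_bound: "\<And>t. expectation (\<lambda>\<omega>. (norm (\<Sum>k=1..p. u t k \<omega>))\<^sup>2) \<le> U\<^sup>2"
    and step_pos: "0 < \<gamma>"
begin

abbreviation F :: "real^'d \<Rightarrow> real" where
  "F \<equiv> objective n f \<zeta>"

lemma L_pos: "0 < L"
  using smooth by (simp add: L_smooth_def)

lemma G_pos: "0 < G"
  using stochastic by (simp add: bounded_stochastic_gradient_def)

text \<open>\<open>grad\<close> is a definite description, so it has to be tied to an actual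
  derivative; differentiability passes from the summands to F.\<close>

lemma GDERIV_F: "GDERIV F x :> grad F x"
proof (rule GDERIV_grad)
  have "(\<lambda>w. (1 / real n) * (\<Sum>i=1..n. f w (\<zeta> i))) differentiable (at x)"
    using diff by (intro differentiable_mult differentiable_const differentiable_sum) auto
  then show "F differentiable (at x)"
    by (simp add: objective_def[abs_def])
qed

lemma norm_grad_diff_le: "norm (grad F x - grad F y) \<le> L * norm (x - y)"
  using smooth by (simp add: L_smooth_def)

lemma expectation_stoch_grad: "expectation (stoch_grad t x) = grad F x"
  using stochastic by (simp add: bounded_stochastic_gradient_def stoch_grad_def[abs_def])

lemma second_moment_stoch_grad: "expectation (\<lambda>\<omega>. (norm (stoch_grad t x \<omega>))\<^sup>2) \<le> G\<^sup>2"
  using stochastic by (simp add: bounded_stochastic_gradient_def stoch_grad_def[abs_def])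

text \<open>The gradient is the mean of the stochastic gradient at any iteration, here iteration 0.
  This pointwise bound is what lets first moments of \<open>gsum\<close> and \<open>usum\<close>
  suffice later.\<close>

lemma norm_grad_le: "norm (grad F x) \<le> G"
proof -
  have "norm (grad F x) \<le> expectation (\<lambda>\<omega>. norm (stoch_grad 0 x \<omega>))"
    unfolding expectation_stoch_grad[of 0, symmetric] by (rule integral_norm_bound)
  also have "\<dots> \<le> G"
    by (rule expectation_le_of_square[OF simple_function_compose1[OF
          simple_batch_imp_simple[OF simple_stoch_grad], where g = norm]])
       (use second_moment_stoch_grad G_pos in auto)
  finally show ?thesis .
qed

definition step_grad :: "nat \<Rightarrow> 'o \<Rightarrow> real^'d" where
  "step_grad t \<omega> = stoch_grad t (w t \<omega>) \<omega>"

text \<open>This vector mixes the past with the current batch, so in general neither algebra alone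
  covers it. It is recovered from two consecutive momentum sums.\<close>

lemma simple_step_grad: "simple_function M (step_grad t)"
proof -
  have "simple_function M (\<lambda>\<omega>. gsum (Suc t) \<omega> - \<beta> *\<^sub>R gsum t \<omega>)"
    by (intro simple_function_compose2[where h = "\<lambda>x y. x - \<beta> *\<^sub>R y"] simple_past_imp_simple[OF simple_gsum])
  then show ?thesis
    by (subst simple_function_cong) (auto simp: gsum_Suc step_grad_def)
qed

text \<open>The batches of iteration t are independent of \<open>w t\<close>, so freezing reduces
  the claim to the bound at deterministic points.\<close>

lemma second_moment_step_grad: "expectation (\<lambda>\<omega>. (norm (step_grad t \<omega>))\<^sup>2) \<le> G\<^sup>2"
proof -
  have "expectation (\<lambda>\<omega>. (norm (step_grad t \<omega>))\<^sup>2)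
      = expectation (\<lambda>\<omega>. expectation (\<lambda>\<omega>'. (norm (stoch_grad t (w t \<omega>) \<omega>'))\<^sup>2))"
    unfolding step_grad_def
    by (rule expectation_freeze[OF indep_algebras _ _ simple_w, where H = "\<lambda>x \<omega>'. (norm (stoch_grad t x \<omega>'))\<^sup>2"])
       (auto intro: simple_function_compose1[where g = "\<lambda>v. (norm v)\<^sup>2"] simple_stoch_grad)
  also have "\<dots> \<le> G\<^sup>2"
    by (intro integral_le_const integrable_simple AE_I2 second_moment_stoch_grad
        simple_function_compose1[OF simple_past_imp_simple[OF simple_w]])
  finally show ?thesis .
qed

lemma expectation_norm_step_grad_le: "expectation (\<lambda>\<omega>. norm (step_grad t \<omega>)) \<le> G"
  by (rule expectation_le_of_square[OF simple_function_compose1[OF simple_step_grad, where g = norm]])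
     (use second_moment_step_grad G_pos in auto)

text \<open>The bound is the fixed point of \<open>x \<mapsto> \<beta> x + G\<close>, hence
  preserved by the momentum recursion.\<close>

lemma expectation_norm_gsum_le: "expectation (\<lambda>\<omega>. norm (gsum t \<omega>)) \<le> G / (1 - \<beta>)"
proof (induction t)
  case 0
  have "expectation (\<lambda>\<omega>. norm (gsum 0 \<omega>)) = expectation (\<lambda>\<omega>. 0)"
    by (rule Bochner_Integration.integral_cong) (simp_all add: gsum_0)
  then show ?case using momentum G_pos by simp
next
  case (Suc t)
  have int: "integrable M (\<lambda>\<omega>. norm (gsum t \<omega>))" "integrable M (\<lambda>\<omega>. norm (gsum (Suc t) \<omega>))"
      "integrable M (\<lambda>\<omega>. norm (step_grad t \<omega>))"
    by (intro integrable_norm integrable_simple simple_past_imp_simple[OF simple_gsum] simple_step_grad)+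
  have "expectation (\<lambda>\<omega>. norm (gsum (Suc t) \<omega>))
      \<le> expectation (\<lambda>\<omega>. \<beta> * norm (gsum t \<omega>) + norm (step_grad t \<omega>))"
    using momentum int
    by (intro integral_mono Bochner_Integration.integrable_add integrable_mult_right)
       (auto simp: gsum_Suc step_grad_def intro: order_trans[OF norm_triangle_ineq])
  also have "\<dots> = \<beta> * expectation (\<lambda>\<omega>. norm (gsum t \<omega>)) + expectation (\<lambda>\<omega>. norm (step_grad t \<omega>))"
    using int by simp
  also have "\<dots> \<le> \<beta> * (G / (1 - \<beta>)) + G"
    by (intro add_mono mult_left_mono Suc momentum expectation_norm_step_grad_le)
  also have "\<dots> = G / (1 - \<beta>)"
    using momentum by (simp add: field_simps)
  finally show ?case .
qed

lemma expectation_norm_usum_le: "expectation (\<lambda>\<omega>. norm (usum t \<omega>)) \<le> U"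
  by (rule expectation_le_of_square[OF simple_function_compose1[OF
        simple_past_imp_simple[OF simple_usum], where g = norm]])
     (use U_bound U_nonneg in \<open>auto simp: usum_def\<close>)

section \<open>The auxiliary iterates and descent along them\<close>

text \<open>This is the \<open>z\<close> of the theorem; the coefficient of \<open>gsum\<close> is \<open>\<rho>\<close>, negative for \<open>\<beta> > 0\<close>.\<close>

definition aux_iterate :: "nat \<Rightarrow> 'o \<Rightarrow> real^'d" where
  "aux_iterate t \<omega> = w t \<omega> - (\<beta> * \<gamma> / (1 - \<beta>)) *\<^sub>R gsum t \<omega> - \<gamma> *\<^sub>R usum t \<omega>"

lemma simple_aux_iterate: "simple_function (past_algebra t) (aux_iterate t)"
  unfolding aux_iterate_def
  by (intro simple_function_diff simple_function_compose1[OF simple_gsum]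
      simple_function_compose1[OF simple_usum] simple_w)

lemma aux_iterate_0: "\<omega> \<in> space M \<Longrightarrow> aux_iterate 0 \<omega> = w0"
  by (simp add: aux_iterate_def gsum_0 usum_0 w_0)

lemma aux_iterate_Suc:
  assumes \<omega>: "\<omega> \<in> space M"
  shows "aux_iterate (Suc t) \<omega> = aux_iterate t \<omega> - (\<gamma> / (1 - \<beta>)) *\<^sub>R step_grad t \<omega>"
proof -
  define a c where "a = \<gamma> / (1 - \<beta>)" and "c = \<beta> * \<gamma> / (1 - \<beta>)"
  \<comment> \<open>These two identities force the value of c: the first collects all of
    \<open>gsum (Suc t)\<close> under the factor a, and the second makes the old momentum inside it
    reproduce the term of \<open>aux_iterate t\<close>.\<close>
  have a: "a = c + \<gamma>" and c: "c = a * \<beta>"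
    using momentum by (simp_all add: a_def c_def divide_simps) (simp add: algebra_simps)
  have "aux_iterate (Suc t) \<omega> = w t \<omega> - \<gamma> *\<^sub>R usum t \<omega> - a *\<^sub>R gsum (Suc t) \<omega>"
    using corrected_iterate_Suc[OF \<omega>, of t]
    by (simp add: aux_iterate_def c_def[symmetric] a scaleR_add_left scaleR_add_right diff_eq_eq add_ac)
  also have "\<dots> = aux_iterate t \<omega> - a *\<^sub>R step_grad t \<omega>"
    by (simp add: aux_iterate_def c_def[symmetric] c gsum_Suc[OF \<omega>] step_grad_def scaleR_add_right)
  finally show ?thesis by (simp add: a_def)
qed

text \<open>Both \<open>w t\<close> and \<open>aux_iterate t\<close> are determined by the past, so
  they are frozen as a pair and unbiasedness applies at the first component.\<close>

lemma expectation_inner_step_grad: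
  "expectation (\<lambda>\<omega>. inner (step_grad t \<omega>) (grad F (aux_iterate t \<omega>)))
    = expectation (\<lambda>\<omega>. inner (grad F (w t \<omega>)) (grad F (aux_iterate t \<omega>)))"
proof -
  let ?H = "\<lambda>x \<omega>. inner (stoch_grad t (fst x) \<omega>) (grad F (snd x))"
  let ?X = "\<lambda>\<omega>. (w t \<omega>, aux_iterate t \<omega>)"
  have "expectation (\<lambda>\<omega>. ?H (?X \<omega>) \<omega>) = expectation (\<lambda>\<omega>. expectation (?H (?X \<omega>)))"
    by (rule expectation_freeze[OF indep_algebras _ _ simple_function_Pair[OF simple_w simple_aux_iterate]])
       (auto intro: simple_function_compose1[OF simple_stoch_grad])
  moreover have "expectation (\<lambda>\<omega>. inner (stoch_grad t x \<omega>) v) = inner (grad F x) v" for x v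
    using integral_inner_left[OF integrable_simple[OF simple_batch_imp_simple[OF simple_stoch_grad]],
        of t x v]
    by (cases "v = 0") (simp_all add: expectation_stoch_grad)
  ultimately show ?thesis by (simp add: step_grad_def)
qed

lemma expected_descent:
  "\<gamma> / (1 - \<beta>) * expectation (\<lambda>\<omega>. (norm (grad F (w t \<omega>)))\<^sup>2)
    \<le> expectation (\<lambda>\<omega>. F (aux_iterate t \<omega>)) - expectation (\<lambda>\<omega>. F (aux_iterate (Suc t) \<omega>))
      + \<gamma> / (1 - \<beta>) * (G * L * (\<beta> * \<gamma> / (1 - \<beta>) * (G / (1 - \<beta>)) + \<gamma> * U))
      + L / 2 * ((\<gamma> / (1 - \<beta>))\<^sup>2 * G\<^sup>2)"
proof -
  define a c where "a = \<gamma> / (1 - \<beta>)" and "c = \<beta> * \<gamma> / (1 - \<beta>)"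
  note ac = a_def[symmetric] c_def[symmetric]
  have a: "0 < a" and c: "0 \<le> c" using momentum step_pos by (simp_all add: a_def c_def)
  note sM = simple_past_imp_simple[OF simple_aux_iterate] simple_past_imp_simple[OF simple_w]
    simple_past_imp_simple[OF simple_gsum] simple_past_imp_simple[OF simple_usum] simple_step_grad
  \<comment> \<open>Any function of simple functions is simple, so no measurability of F or its
    gradient has to be established.\<close>
  have int: "integrable M (\<lambda>\<omega>. F (aux_iterate s \<omega>))"
      "integrable M (\<lambda>\<omega>. (norm (step_grad s \<omega>))\<^sup>2)"
      "integrable M (\<lambda>\<omega>. inner (step_grad s \<omega>) (grad F (aux_iterate s \<omega>)))"
      "integrable M (\<lambda>\<omega>. inner (grad F (w s \<omega>)) (grad F (aux_iterate s \<omega>)))"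
      "integrable M (\<lambda>\<omega>. (norm (grad F (w s \<omega>)))\<^sup>2)"
      "integrable M (\<lambda>\<omega>. norm (gsum s \<omega>))" "integrable M (\<lambda>\<omega>. norm (usum s \<omega>))" for s
    by (intro integrable_simple simple_function_compose1[OF sM(1), where g = F]
        simple_function_compose1[OF sM(5), where g = "\<lambda>v. (norm v)\<^sup>2"]
        simple_function_compose2[OF sM(5) sM(1), where h = "\<lambda>x y. inner x (grad F y)"]
        simple_function_compose2[OF sM(2) sM(1), where h = "\<lambda>x y. inner (grad F x) (grad F y)"]
        simple_function_compose1[OF sM(2), where g = "\<lambda>v. (norm (grad F v))\<^sup>2"]
        simple_function_compose1[OF sM(3), where g = norm]
        simple_function_compose1[OF sM(4), where g = norm])+
  have "expectation (\<lambda>\<omega>. F (aux_iterate (Suc t) \<omega>))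
      \<le> expectation (\<lambda>\<omega>. F (aux_iterate t \<omega>)
          - a * inner (step_grad t \<omega>) (grad F (aux_iterate t \<omega>))
          + L / 2 * (a\<^sup>2 * (norm (step_grad t \<omega>))\<^sup>2))"
  proof (rule integral_mono)
    fix \<omega> assume "\<omega> \<in> space M"
    with descent_lemma[OF GDERIV_F smooth, of "aux_iterate (Suc t) \<omega>" "aux_iterate t \<omega>"]
    show "F (aux_iterate (Suc t) \<omega>) \<le> F (aux_iterate t \<omega>)
          - a * inner (step_grad t \<omega>) (grad F (aux_iterate t \<omega>))
          + L / 2 * (a\<^sup>2 * (norm (step_grad t \<omega>))\<^sup>2)"
      by (simp add: aux_iterate_Suc ac power_mult_distrib)
  qed (intro Bochner_Integration.integrable_add Bochner_Integration.integrable_diff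
      integrable_mult_right int)+
  also have "\<dots> = expectation (\<lambda>\<omega>. F (aux_iterate t \<omega>))
      - a * expectation (\<lambda>\<omega>. inner (grad F (w t \<omega>)) (grad F (aux_iterate t \<omega>)))
      + L / 2 * (a\<^sup>2 * expectation (\<lambda>\<omega>. (norm (step_grad t \<omega>))\<^sup>2))"
    by (simp add: int expectation_inner_step_grad)
  also have "\<dots> \<le> expectation (\<lambda>\<omega>. F (aux_iterate t \<omega>))
      - a * expectation (\<lambda>\<omega>. inner (grad F (w t \<omega>)) (grad F (aux_iterate t \<omega>)))
      + L / 2 * (a\<^sup>2 * G\<^sup>2)"
    using L_pos by (intro add_left_mono mult_left_mono second_moment_step_grad) simp_all
  finally have descent: "a * expectation (\<lambda>\<omega>. inner (grad F (w t \<omega>)) (grad F (aux_iterate t \<omega>)))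
      \<le> expectation (\<lambda>\<omega>. F (aux_iterate t \<omega>)) - expectation (\<lambda>\<omega>. F (aux_iterate (Suc t) \<omega>))
        + L / 2 * (a\<^sup>2 * G\<^sup>2)"
    by linarith
  \<comment> \<open>The descent inequality only produces the inner product of the gradients at
    \<open>w t\<close> and \<open>aux_iterate t\<close>. Replacing it by the squared gradient at
    \<open>w t\<close> costs at most G times L times the distance of the two points.\<close>
  have "expectation (\<lambda>\<omega>. (norm (grad F (w t \<omega>)))\<^sup>2)
      \<le> expectation (\<lambda>\<omega>. inner (grad F (w t \<omega>)) (grad F (aux_iterate t \<omega>))
          + G * L * (c * norm (gsum t \<omega>) + \<gamma> * norm (usum t \<omega>)))"
  proof (rule integral_mono)
    fix \<omega> assume "\<omega> \<in> space M"
    let ?x = "w t \<omega>" and ?z = "aux_iterate t \<omega>"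
    have "norm (?x - ?z) \<le> c * norm (gsum t \<omega>) + \<gamma> * norm (usum t \<omega>)"
      using norm_triangle_ineq[of "c *\<^sub>R gsum t \<omega>" "\<gamma> *\<^sub>R usum t \<omega>"] c step_pos
      by (simp add: aux_iterate_def ac)
    then have "L * norm (?x - ?z) \<le> L * (c * norm (gsum t \<omega>) + \<gamma> * norm (usum t \<omega>))"
      using L_pos by (intro mult_left_mono) auto
    with norm_grad_diff_le[of ?x ?z]
    have "norm (grad F ?x - grad F ?z) \<le> L * (c * norm (gsum t \<omega>) + \<gamma> * norm (usum t \<omega>))"
      by linarith
    then have "inner (grad F ?x) (grad F ?x - grad F ?z)
        \<le> G * (L * (c * norm (gsum t \<omega>) + \<gamma> * norm (usum t \<omega>)))"
      using G_pos by (intro order_trans[OF norm_cauchy_schwarz] mult_mono norm_grad_le) simp_all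
    then show "(norm (grad F ?x))\<^sup>2 \<le> inner (grad F ?x) (grad F ?z)
          + G * L * (c * norm (gsum t \<omega>) + \<gamma> * norm (usum t \<omega>))"
      unfolding inner_diff_right power2_norm_eq_inner mult.assoc by linarith
  qed (intro Bochner_Integration.integrable_add integrable_mult_right int)+
  also have "\<dots> = expectation (\<lambda>\<omega>. inner (grad F (w t \<omega>)) (grad F (aux_iterate t \<omega>)))
      + G * L * (c * expectation (\<lambda>\<omega>. norm (gsum t \<omega>)) + \<gamma> * expectation (\<lambda>\<omega>. norm (usum t \<omega>)))"
    by (simp add: int)
  also have "\<dots> \<le> expectation (\<lambda>\<omega>. inner (grad F (w t \<omega>)) (grad F (aux_iterate t \<omega>)))
      + G * L * (c * (G / (1 - \<beta>)) + \<gamma> * U)"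
    by (intro add_left_mono mult_left_mono add_mono expectation_norm_gsum_le expectation_norm_usum_le
        c less_imp_le[OF step_pos] mult_nonneg_nonneg less_imp_le[OF G_pos] less_imp_le[OF L_pos])
  finally have "a * expectation (\<lambda>\<omega>. (norm (grad F (w t \<omega>)))\<^sup>2)
      \<le> a * (expectation (\<lambda>\<omega>. inner (grad F (w t \<omega>)) (grad F (aux_iterate t \<omega>)))
      + G * L * (c * (G / (1 - \<beta>)) + \<gamma> * U))"
    using a by (intro mult_left_mono) auto
  with descent show ?thesis
    unfolding ac distrib_left[of a] by linarith
qed

lemma average_gradient_bound:
  assumes minimizer: "\<And>v. F wstar \<le> F v" and T: "T \<ge> 1"
  shows "1 / ((1 - \<beta>) * real T) * (\<Sum>t<T. expectation (\<lambda>\<omega>. (norm (grad F (w t \<omega>)))\<^sup>2))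
    \<le> (F w0 - F wstar) / (real T * \<gamma>)
      + (L * G\<^sup>2 * \<beta> / (1 - \<beta>) ^ 3 + L * G * U / (1 - \<beta>) + L * G\<^sup>2 / (2 * (1 - \<beta>)\<^sup>2)) * \<gamma>"
proof -
  define Z where "Z t = expectation (\<lambda>\<omega>. F (aux_iterate t \<omega>))" for t
  define S where "S = (\<Sum>t<T. expectation (\<lambda>\<omega>. (norm (grad F (w t \<omega>)))\<^sup>2))"
  define q where "q = 1 - \<beta>"
  define E where "E = \<gamma> / q * (G * L * (\<beta> * \<gamma> / q * (G / q) + \<gamma> * U)) + L / 2 * ((\<gamma> / q)\<^sup>2 * G\<^sup>2)"
  have q: "0 < q" using momentum by (simp add: q_def)
  have "Z 0 = expectation (\<lambda>\<omega>. F w0)"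
    unfolding Z_def by (rule Bochner_Integration.integral_cong) (simp_all add: aux_iterate_0)
  then have Z_0: "Z 0 = F w0" by (simp add: prob_space)
  have Z_T: "F wstar \<le> Z T"
    unfolding Z_def
    by (intro integral_ge_const AE_I2 minimizer integrable_simple
        simple_function_compose1[OF simple_past_imp_simple[OF simple_aux_iterate]])
  have "\<gamma> / q * S \<le> (\<Sum>t<T. (Z t - Z (Suc t)) + E)"
    unfolding S_def sum_distrib_left Z_def E_def q_def
    by (intro sum_mono order_trans[OF expected_descent]) (simp only: add.assoc order_refl)
  also have "\<dots> = Z 0 - Z T + real T * E"
    unfolding sum.distrib sum_lessThan_telescope'[of Z] by simp
  finally have "\<gamma> / q * S \<le> F w0 - F wstar + real T * E"
    using Z_0 Z_T by linarith
  \<comment> \<open>Dividing by \<open>real T * \<gamma>\<close> leaves the factor 1/q, that is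
    1/(1-\<beta>), on the left.\<close>
  then have "\<gamma> / q * S / (real T * \<gamma>) \<le> (F w0 - F wstar + real T * E) / (real T * \<gamma>)"
    using T step_pos by (intro divide_right_mono) simp_all
  also have "\<dots> = (F w0 - F wstar) / (real T * \<gamma>) + E / \<gamma>"
    using T by (simp add: add_divide_distrib)
  \<comment> \<open>The three summands come from the momentum part of the distance between the two
    sequences, from its memory part, and from the quadratic term of the descent inequality.\<close>
  also have "E / \<gamma> = (L * G\<^sup>2 * \<beta> / q ^ 3 + L * G * U / q + L * G\<^sup>2 / (2 * q\<^sup>2)) * \<gamma>"
    using q step_pos unfolding E_def by (simp add: field_simps power2_eq_square power3_eq_cube)
  also have "\<gamma> / q * S / (real T * \<gamma>) = 1 / (q * real T) * S"
    using T step_pos q by simp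
  finally show ?thesis unfolding S_def q_def .
qed

end

section \<open>The explicit bound and its asymptotic form\<close>

theorem theorem10:
  fixes n p b :: nat
    and f :: "real^'d \<Rightarrow> 'z \<Rightarrow> real"
    and \<zeta> :: "nat \<Rightarrow> 'z"
    and F :: "real^'d \<Rightarrow> real"
    and w0 wstar :: "real^'d"
    and \<beta> L G U C :: real
  assumes n_pos: "n \<ge> 1"
    and diff: "\<And>i v. i \<in> {1..n} \<Longrightarrow> (\<lambda>v. f v (\<zeta> i)) differentiable (at v)"
    and F_def: "F = objective n f \<zeta>"
    and minimizer: "\<And>v. F wstar \<le> F v"
    and smooth: "L_smooth L F"
    and sample_bound: "\<And>v. (1 / real n) * (\<Sum>i=1..n. (norm (grad (\<lambda>v. f v (\<zeta> i)) v))\<^sup>2) \<le> G\<^sup>2"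
    and U_nonneg: "U \<ge> 0"
    and C_def: "C = L * G\<^sup>2 * \<beta> / (1 - \<beta>) ^ 3 + L * G * U / (1 - \<beta>) + L * G\<^sup>2 / (2 * (1 - \<beta>)\<^sup>2)"
  shows
    "(\<forall>(M :: 'o measure) eta I m w u g (rho :: int \<Rightarrow> real) z \<eta> T.
        mdsgd M n f \<zeta> p b \<beta> eta w0 I m w u g \<longrightarrow>
        bounded_stochastic_gradient M n f \<zeta> p b I G \<longrightarrow>
        (\<forall>t. (\<integral>\<omega>. (norm (\<Sum>k=1..p. u t k \<omega>))\<^sup>2 \<partial>M) \<le> U\<^sup>2) \<longrightarrow>
        (\<forall>t. \<forall>\<omega>\<in>space M. z t \<omega> = w t \<omega> + rho (int t - 1) *\<^sub>R (\<Sum>k=1..p. g (int t - 1) k \<omega>)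
                                  - eta t *\<^sub>R (\<Sum>k=1..p. u t k \<omega>)) \<longrightarrow>
        (\<forall>t. \<beta> * rho (int t) = \<beta> * eta t + rho (int t - 1)) \<longrightarrow>
        \<eta> > 0 \<longrightarrow> (\<forall>t. eta t = \<eta>) \<longrightarrow> (\<forall>t. rho t = \<beta> * \<eta> / (\<beta> - 1)) \<longrightarrow> T \<ge> 1 \<longrightarrow>
        1 / ((1 - \<beta>) * real T) * (\<Sum>t<T. \<integral>\<omega>. (norm (grad F (w t \<omega>)))\<^sup>2 \<partial>M)
          \<le> (F w0 - F wstar) / (real T * \<eta>) + C * \<eta>)
     \<and>
     (\<forall>(M :: nat \<Rightarrow> 'o measure) I m w u g (\<eta> :: nat \<Rightarrow> real).
        (\<forall>T\<ge>1. \<eta> T > 0 \<and>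
           mdsgd (M T) n f \<zeta> p b \<beta> (\<lambda>_. \<eta> T) w0 (I T) (m T) (w T) (u T) (g T) \<and>
           bounded_stochastic_gradient (M T) n f \<zeta> p b (I T) G \<and>
           (\<forall>t. (\<integral>\<omega>. (norm (\<Sum>k=1..p. u T t k \<omega>))\<^sup>2 \<partial>(M T)) \<le> U\<^sup>2)) \<longrightarrow>
        \<eta> \<in> \<Theta>(\<lambda>T. 1 / sqrt (real T)) \<longrightarrow>
        (\<lambda>T. 1 / real T * (\<Sum>t<T. \<integral>\<omega>. (norm (grad F (w T t \<omega>)))\<^sup>2 \<partial>(M T)))
          \<in> O(\<lambda>T. 1 / sqrt (real T)))"
proof (intro conjI allI impI)
  fix M :: "'o measure" and eta I m w u g and rho :: "int \<Rightarrow> real" and z \<eta> and T :: nat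
  assume run: "mdsgd M n f \<zeta> p b \<beta> eta w0 I m w u g"
    and stoch: "bounded_stochastic_gradient M n f \<zeta> p b I G"
    and U_bound: "\<forall>t. (\<integral>\<omega>. (norm (\<Sum>k=1..p. u t k \<omega>))\<^sup>2 \<partial>M) \<le> U\<^sup>2"
    and step: "\<eta> > 0" "\<forall>t. eta t = \<eta>" and T: "T \<ge> 1"
  from step(2) have "eta = (\<lambda>_. \<eta>)" by blast
  with run have "smooth_mdsgd M n f \<zeta> p b \<beta> \<eta> w0 I m w u g L G U"
    using diff smooth stoch U_nonneg U_bound step(1)
    by (auto intro!: smooth_mdsgd.intro smooth_mdsgd_axioms.intro simp: F_def)
  from smooth_mdsgd.average_gradient_bound[OF this minimizer[unfolded F_def] T]
  show "1 / ((1 - \<beta>) * real T) * (\<Sum>t<T. \<integral>\<omega>. (norm (grad F (w t \<omega>)))\<^sup>2 \<partial>M)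
      \<le> (F w0 - F wstar) / (real T * \<eta>) + C * \<eta>"
    unfolding C_def F_def .
next
  \<comment> \<open>The rate depends on the horizon T, so each T has its own run on its own
    probability space; \<open>w T t\<close> is iterate t of that run.\<close>
  fix M :: "nat \<Rightarrow> 'o measure" and I m w u g and \<eta> :: "nat \<Rightarrow> real"
  assume runs: "\<forall>T\<ge>1. \<eta> T > 0 \<and>
           mdsgd (M T) n f \<zeta> p b \<beta> (\<lambda>_. \<eta> T) w0 (I T) (m T) (w T) (u T) (g T) \<and>
           bounded_stochastic_gradient (M T) n f \<zeta> p b (I T) G \<and>
           (\<forall>t. (\<integral>\<omega>. (norm (\<Sum>k=1..p. u T t k \<omega>))\<^sup>2 \<partial>(M T)) \<le> U\<^sup>2)"
    and rate: "\<eta> \<in> \<Theta>(\<lambda>T. 1 / sqrt (real T))"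
  let ?S = "\<lambda>T. \<Sum>t<T. \<integral>\<omega>. (norm (grad F (w T t \<omega>)))\<^sup>2 \<partial>(M T)"
  \<comment> \<open>The explicit bound multiplied by 1-\<beta>, with
    \<open>1 / (real T * \<eta> T)\<close> isolated for the Landau rules.\<close>
  let ?B = "\<lambda>T. (1 - \<beta>) * ((F w0 - F wstar) * (1 / (real T * \<eta> T)) + C * \<eta> T)"
  have bound: "1 / real T * ?S T \<le> ?B T" if T: "T \<ge> 1" for T
  proof -
    have run: "smooth_mdsgd (M T) n f \<zeta> p b \<beta> (\<eta> T) w0 (I T) (m T) (w T) (u T) (g T) L G U"
      using diff smooth U_nonneg runs T
      by (auto intro!: smooth_mdsgd.intro smooth_mdsgd_axioms.intro simp: F_def)
    then have "mdsgd (M T) n f \<zeta> p b \<beta> (\<lambda>_. \<eta> T) w0 (I T) (m T) (w T) (u T) (g T)"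
      by (rule smooth_mdsgd.axioms)
    then have \<beta>: "\<beta> < 1" by (rule mdsgd.momentum)
    have "1 / ((1 - \<beta>) * real T) * ?S T \<le> (F w0 - F wstar) / (real T * \<eta> T) + C * \<eta> T"
      using smooth_mdsgd.average_gradient_bound[OF run minimizer[unfolded F_def] T]
      unfolding C_def F_def .
    then have "(1 - \<beta>) * (1 / ((1 - \<beta>) * real T) * ?S T) \<le> ?B T"
      using \<beta> by (intro mult_left_mono) simp_all
    moreover have "(1 - \<beta>) * (1 / ((1 - \<beta>) * real T) * ?S T) = 1 / real T * ?S T"
      using \<beta> by simp
    ultimately show ?thesis by linarith
  qed
  have "(\<lambda>T. 1 / real T * ?S T) \<in> O(?B)"
  proof (rule landau_o.bigI[of 1], simp)
    show "\<forall>\<^sub>F T in sequentially. norm (1 / real T * ?S T) \<le> 1 * norm (?B T)"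
      using eventually_ge_at_top[of 1]
    proof eventually_elim
      case (elim T)
      have "0 \<le> 1 / real T * ?S T" by (intro mult_nonneg_nonneg sum_nonneg) simp_all
      with bound[OF elim] show ?case by (simp only: real_norm_def mult_1_left)
    qed
  qed
  also have "?B \<in> O(\<lambda>T. 1 / sqrt (real T))"
  proof -
    \<comment> \<open>The reciprocal of the rate appears here, so the lower bound in \<Theta>
      matters as well as the upper one.\<close>
    have "(\<lambda>T. 1 / (real T * \<eta> T)) \<in> \<Theta>(\<lambda>T. 1 / (real T * (1 / sqrt (real T))))"
      by (intro bigtheta_divide landau_theta.mult rate bigtheta_refl)
    moreover have "(\<lambda>T. 1 / (real T * (1 / sqrt (real T)))) = (\<lambda>T. 1 / sqrt (real T))"
      by (simp add: real_div_sqrt)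
    ultimately have "(\<lambda>T. 1 / (real T * \<eta> T)) \<in> O(\<lambda>T. 1 / sqrt (real T))"
      by (simp add: bigthetaD1)
    then have "(\<lambda>T. (F w0 - F wstar) * (1 / (real T * \<eta> T)) + C * \<eta> T) \<in> O(\<lambda>T. 1 / sqrt (real T))"
      using bigthetaD1[OF rate] by (intro sum_in_bigo) (simp_all only: cmult_in_bigo_iff simp_thms)
    then show ?thesis by simp
  qed
  finally show "(\<lambda>T. 1 / real T * ?S T) \<in> O(\<lambda>T. 1 / sqrt (real T))" .
qed

end
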